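(* Let $n\ge k\ge 0$ be integers. Then $$A_{n,k}(u,v,q)=\sum_{\lambda\in A_{n,k}}q^{|\lambda|}u^{|\lfloor\lambda\rfloor|}v^{o(\lfloor\lambda\rfloor)}=\begin{bmatrix} n\\ k\end{bmatrix}_q\frac{(-uvq^{n-k+1};q)_k}{(u^2q^{2(n-k+1)};q)_k}.$$
   Context: For $n\ge k$, $A_{n,k}$ is the set of truncated anti-lecture hall compositions: sequences $\lambda=(\lambda_1,\ldots,\lambda_k)$ of nonnegative integers with $$\frac{\lambda_1}{n-k+1}\ge\frac{\lambda_2}{n-k+2}\ge\cdots\ge\frac{\lambda_k}{n}\ge 0$$ (for $k=0$ the set consists of the empty sequence only). For a finite sequence $\mu$ of nonnegative integers, $|\mu|$ is the sum of its entries and $o(\mu)$ is the number of odd entries. For $\lambda\in A_{n,k}$, $\lfloor\lambda\rfloor=(\lfloor\lambda_1/(n-k+1)\rfloor,\lfloor\lambda_2/(n-k+2)\rfloor,\ldots,\lfloor\lambda_k/n\rfloor)$. Notation: $(a;q)_m=\prod_{i=0}^{m-1}(1-aq^i)$ and $\begin{bmatrix} n\\ m\end{bmatrix}_q=(q^{n-m+1};q)_m/(q;q)_m$ (Gaussian polynomial). Identities are between formal power series in $q$ (rational functions being expanded in powers of $q$). *)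

theory Defs
  imports
    "HOL-Computational_Algebra.Formal_Power_Series"
    "HOL-Analysis.Infinite_Sum"
begin

text \<open>
  Sequences are lists indexed from 0, so the entry \<open>\<lambda>\<^sub>i\<close> (\<open>1 \<le> i \<le> k\<close>) is \<open>l ! (i - 1)\<close>, and
  the denominator \<open>n - k + i\<close> belonging to it becomes \<open>n - k + 1 + j\<close> for the list index \<open>j = i - 1\<close>.
  The subtraction \<open>n - k\<close> is on natural numbers, so everything below is meant for \<open>k \<le> n\<close>.
  The final condition \<open>\<lambda>\<^sub>k / n \<ge> 0\<close> is automatic, as the entries are natural numbers.
\<close>

definition anti_lecture_hall :: "nat \<Rightarrow> nat \<Rightarrow> nat list set" where
  "anti_lecture_hall n k =
     {l. length l = k \<and>
         (\<forall>j. Suc j < k \<longrightarrow>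
            real (l ! j) / real (n - k + 1 + j) \<ge> real (l ! Suc j) / real (n - k + 1 + Suc j))}"

text \<open>The entrywise floor; \<open>div\<close> on natural numbers is the floor of the quotient.\<close>

definition alh_floor :: "nat \<Rightarrow> nat \<Rightarrow> nat list \<Rightarrow> nat list" where
  "alh_floor n k l = map (\<lambda>j. (l ! j) div (n - k + 1 + j)) [0..<k]"

definition num_odd :: "nat list \<Rightarrow> nat" where
  "num_odd l = length (filter odd l)"

definition q_pochhammer :: "'a::comm_ring_1 \<Rightarrow> 'a \<Rightarrow> nat \<Rightarrow> 'a" where
  "q_pochhammer a q m = (\<Prod>i<m. 1 - a * q ^ i)"

text \<open>
  The Gaussian polynomial as a power series in the variable \<open>q = fps_X\<close>. The denominator has
  constant coefficient 1, so the division is by a unit of the power series ring.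
\<close>

definition gaussian_poly :: "nat \<Rightarrow> nat \<Rightarrow> 'a::field fps" where
  "gaussian_poly n m =
     q_pochhammer (fps_X ^ (n - m + 1)) fps_X m / q_pochhammer fps_X fps_X m"

text \<open>
  The summand \<open>q\<^bsup>|\<lambda>|\<^esup> u\<^bsup>|\<lfloor>\<lambda>\<rfloor>|\<^esup> v\<^bsup>o(\<lfloor>\<lambda>\<rfloor>)\<^esup>\<close>, where \<open>q = fps_X\<close>. The parameters
  \<open>u\<close> and \<open>v\<close> are arbitrary elements of an arbitrary coefficient field; formal variables \<open>u\<close> and \<open>v\<close>
  are the instance in which this field is a field of rational functions in them.
  Infinite sums of such summands are taken in the library topology of \<^typ>\<open>'a fps\<close>, in which
  two series are close iff they agree up to a high power of \<open>q\<close>.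
\<close>

definition alh_weight :: "nat \<Rightarrow> nat \<Rightarrow> 'a::field \<Rightarrow> 'a \<Rightarrow> nat list \<Rightarrow> 'a fps" where
  "alh_weight n k u v l =
     fps_X ^ sum_list l *
     fps_const (u ^ sum_list (alh_floor n k l) * v ^ num_odd (alh_floor n k l))"

end

theory Submission
  imports Defs
begin

text \<open>
  Put \<open>m = n - k\<close> and let \<open>w\<close> mark the even floors. The entries of \<open>\<lambda>\<close> with floor at least 1 form
  a prefix of some length \<open>j\<close>. Lowering its floors by 1 gives an arbitrary element of \<open>A\<^bsub>m+j,j\<^esub>\<close>
  and swaps the roles of \<open>v\<close> and \<open>w\<close>; the other entries form an arbitrary partition into \<open>k - j\<close>
  parts, possibly 0, of size at most \<open>m + j\<close>. With \<open>x = u q\<^bsup>m+1\<^esup>\<close> this gives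
  \<open>A\<^sub>k(v, w) = \<Sum>\<^sub>j [m + k, k - j] w\<^bsup>k-j\<^esup> (\<Prod>\<^bsub>i<j\<^esub> x q\<^sup>i) A\<^sub>j(w, v)\<close>,
  which determines all \<open>A\<^sub>k\<close> coefficient by coefficient. The product
  \<open>[m + k, k] (\<Prod>\<^bsub>i<k\<^esub> w + v x q\<^sup>i) / (x\<^sup>2; q)\<^sub>k\<close> satisfies the same recursion by a homogeneous
  form of the \<open>q\<close>-Chu--Vandermonde sum. To keep all sums finite, the recursion is iterated on
  sequences with floors below \<open>M\<close>, which suffice for the coefficients of \<open>q\<^sup>N\<close> with \<open>N < M\<close>.
\<close>

section \<open>Partitions in a box\<close>

definition box_partitions :: "nat \<Rightarrow> nat \<Rightarrow> nat list set" where
  "box_partitions a b = {p. length p = a \<and> sorted_wrt (\<ge>) p \<and> set p \<subseteq> {..b}}"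

text \<open>This is the Gaussian polynomial [a + b, a] in combinatorial, division-free form, so that
  its q-Pascal rule becomes a statement about sets.\<close>

definition box_gf :: "nat \<Rightarrow> nat \<Rightarrow> 'a::field fps" where
  "box_gf a b = (\<Sum>p\<in>box_partitions a b. fps_X ^ sum_list p)"

lemma finite_box_partitions [simp]: "finite (box_partitions a b)"
  by (rule finite_subset[OF _ finite_lists_length_eq[of "{..b}" a]])
     (auto simp: box_partitions_def)

lemma box_partitions_0_left [simp]: "box_partitions 0 b = {[]}"
  by (auto simp: box_partitions_def)

lemma box_partitions_0_right [simp]: "box_partitions a 0 = {replicate a 0}"
proof -
  have "p = replicate a 0" if "length p = a" "set p \<subseteq> {0}" for p :: "nat list"
    using that by (intro replicate_eqI) auto
  then show ?thesis
    by (auto simp: box_partitions_def sorted_wrt_iff_nth_less)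
qed

text \<open>Case distinction on whether the head, the largest part, attains the bound. On generating
  functions this is the q-Pascal rule.\<close>

lemma box_partitions_Suc_Suc:
  "box_partitions (Suc a) (Suc b) =
     (#) (Suc b) ` box_partitions a (Suc b) \<union> box_partitions (Suc a) b" (is "?L = ?R")
proof (intro equalityI subsetI)
  fix p assume "p \<in> ?L"
  then obtain x r where p: "p = x # r" "length r = a" "sorted_wrt (\<ge>) r" "set r \<subseteq> {..Suc b}"
      "x \<le> Suc b" "\<forall>y\<in>set r. y \<le> x"
    by (auto simp: box_partitions_def length_Suc_conv)
  then show "p \<in> ?R"
  proof (cases "x = Suc b")
    case False
    then have "x \<le> b" using p by simp
    then show ?thesis using p by (force simp: box_partitions_def)
  qed (auto simp: box_partitions_def)
next
  fix p assume "p \<in> ?R"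
  then show "p \<in> ?L" by (fastforce simp: box_partitions_def)
qed

lemma box_gf_0_left [simp]: "box_gf 0 b = 1"
  by (simp add: box_gf_def)

lemma box_gf_0_right [simp]: "box_gf a 0 = 1"
  by (simp add: box_gf_def sum_list_replicate)

lemma box_gf_Suc_Suc:
  "box_gf (Suc a) (Suc b) = fps_X ^ Suc b * box_gf a (Suc b) + box_gf (Suc a) b"
proof -
  have disj: "(#) (Suc b) ` box_partitions a (Suc b) \<inter> box_partitions (Suc a) b = {}"
    by (auto simp: box_partitions_def)
  show ?thesis
    unfolding box_gf_def box_partitions_Suc_Suc
    by (subst sum.union_disjoint[OF _ _ disj])
       (simp_all add: sum.reindex sum_distrib_left power_add mult.assoc)
qed

section \<open>Product form of the Gaussian polynomial\<close>

lemma q_pochhammer_0 [simp]: "q_pochhammer a q 0 = 1"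
  by (simp add: q_pochhammer_def)

lemma q_pochhammer_Suc: "q_pochhammer a q (Suc k) = q_pochhammer a q k * (1 - a * q ^ k)"
  by (simp add: q_pochhammer_def)

lemma q_pochhammer_add:
  "q_pochhammer a q (m + k) = q_pochhammer a q m * q_pochhammer (a * q ^ m) q k"
  by (induction k) (simp_all add: q_pochhammer_Suc power_add mult_ac)

lemma q_pochhammer_fps_nth_0:
  fixes a :: "'a::field fps"
  assumes "fps_nth a 0 = 0"
  shows "fps_nth (q_pochhammer a fps_X m) 0 = 1"
  using assms by (induction m) (simp_all add: q_pochhammer_Suc)

lemma q_pochhammer_X_nonzero [simp]: "q_pochhammer fps_X fps_X m \<noteq> (0 :: 'a::field fps)"
  using q_pochhammer_fps_nth_0[of "fps_X :: 'a fps" m] by auto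

text \<open>Induction on a + b, since the q-Pascal rule lowers either argument. Denominators are
  cleared so that the induction stays within ring arithmetic.\<close>

lemma box_gf_q_pochhammer:
  "box_gf a b * (q_pochhammer fps_X fps_X a * q_pochhammer fps_X fps_X b) =
     (q_pochhammer fps_X fps_X (a + b) :: 'a::field fps)"
proof (induction "a + b" arbitrary: a b)
  case (Suc s)
  show ?case
  proof (cases "a = 0 \<or> b = 0")
    case False
    then obtain a' b' where ab: "a = Suc a'" "b = Suc b'"
      by (metis not0_implies_Suc)
    let ?Q = "q_pochhammer fps_X fps_X :: nat \<Rightarrow> 'a fps"
    have 1: "box_gf a' b * (?Q a' * ?Q b) = ?Q s" and 2: "box_gf a b' * (?Q a * ?Q b') = ?Q s"
      using Suc(1)[of a' b] Suc(1)[of a b'] Suc(2) ab by simp_all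
    have "box_gf a b * (?Q a * ?Q b) =
        fps_X ^ b * (1 - fps_X ^ a) * (box_gf a' b * (?Q a' * ?Q b))
        + (1 - fps_X ^ b) * (box_gf a b' * (?Q a * ?Q b'))"
      unfolding ab box_gf_Suc_Suc by (simp add: q_pochhammer_Suc algebra_simps)
    \<comment> \<open>Here a + b = \<open>Suc s\<close>, and q^b (1 - q^a) + (1 - q^b) = 1 -
      q^(a+b).\<close>
    also have "\<dots> = ?Q s * (1 - fps_X * fps_X ^ s)"
      unfolding 1 2 using ab Suc(2) by (simp add: algebra_simps flip: power_add power_Suc)
    finally show ?thesis by (simp only: Suc(2)[symmetric] q_pochhammer_Suc)
  qed auto
qed simp

lemma gaussian_poly_eq_box_gf: "gaussian_poly (m + k) k = (box_gf k m :: 'a::field fps)"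
proof -
  let ?Q = "q_pochhammer fps_X fps_X :: nat \<Rightarrow> 'a fps"
  have "?Q m * q_pochhammer (fps_X ^ Suc m) fps_X k = ?Q m * (box_gf k m * ?Q k)"
    using box_gf_q_pochhammer[of k m, where 'a='a] q_pochhammer_add[of fps_X "fps_X :: 'a fps" m k]
    by (simp add: mult_ac add.commute)
  then have "q_pochhammer (fps_X ^ Suc m) fps_X k = box_gf k m * ?Q k"
    by (metis mult_left_cancel q_pochhammer_X_nonzero)
  then show ?thesis
    by (simp add: gaussian_poly_def)
qed

text \<open>Both sides are the q-multinomial coefficient with lower entries k - j, j and m. In the
  recursion this pulls the factor [m + k, k] out of the sum over j.\<close>

lemma box_gf_mult_box_gf:
  assumes "j \<le> k"
  shows "box_gf (k - j) (m + j) * box_gf j m = (box_gf k m * box_gf j (k - j) :: 'a::field fps)"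
proof -
  let ?Q = "q_pochhammer fps_X fps_X :: nat \<Rightarrow> 'a fps"
  have 1: "box_gf (k - j) (m + j) * (?Q (k - j) * ?Q (m + j)) = ?Q (m + k)"
    "box_gf j m * (?Q j * ?Q m) = ?Q (m + j)"
    "box_gf k m * (?Q k * ?Q m) = ?Q (m + k)"
    "box_gf j (k - j) * (?Q j * ?Q (k - j)) = ?Q k"
    using assms by (simp_all add: box_gf_q_pochhammer add.commute)
  have "box_gf (k - j) (m + j) * box_gf j m * (?Q (k - j) * ?Q j * ?Q m)
      = box_gf (k - j) (m + j) * (?Q (k - j) * (box_gf j m * (?Q j * ?Q m)))"
    by (simp only: mult_ac)
  also have "\<dots> = box_gf k m * (box_gf j (k - j) * (?Q j * ?Q (k - j)) * ?Q m)"
    unfolding 1 ..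
  also have "\<dots> = box_gf k m * box_gf j (k - j) * (?Q (k - j) * ?Q j * ?Q m)"
    by (simp only: mult_ac)
  finally show ?thesis
    by simp
qed

section \<open>A homogeneous q-Chu-Vandermonde sum\<close>

text \<open>
  Here \<open>y\<close> has to be independent of \<open>c\<close>, as the induction step replaces \<open>y\<close> by \<open>q y\<close>.
\<close>

lemma q_vandermonde_homogeneous:
  fixes w c y :: "'a::field fps"
  shows "(\<Sum>j\<le>k. box_gf j (k - j) * w ^ (k - j) * (\<Prod>i<j. fps_X ^ i) *
            (\<Prod>i<j. c + w * y * fps_X ^ i) * (\<Prod>i=j..<k. 1 - y * fps_X ^ i))
         = (\<Prod>i<k. w + c * fps_X ^ i)"
proof (induction k arbitrary: y)
  case (Suc k)
  \<comment> \<open>\<open>t\<close> and \<open>s\<close> are the summands for k and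
    \<open>Suc k\<close> without their Gaussian factor; \<open>t\<close> keeps y as an argument
    because it is used at y and at y q.\<close>
  define t where "t y j = w ^ (k - j) * (\<Prod>i<j. fps_X ^ i) *
            (\<Prod>i<j. c + w * y * fps_X ^ i) * (\<Prod>i=j..<k. 1 - y * fps_X ^ i)" for y and j
  define s where "s j = w ^ (Suc k - j) * (\<Prod>i<j. fps_X ^ i) *
            (\<Prod>i<j. c + w * y * fps_X ^ i) * (\<Prod>i=j..<Suc k. 1 - y * fps_X ^ i)" for j
  have IH: "(\<Sum>j\<le>k. box_gf j (k - j) * t y j) = (\<Prod>i<k. w + c * fps_X ^ i)" for y
    using Suc[of y] by (simp add: t_def mult.assoc)
  have s1: "s j = w * (1 - y * fps_X ^ k) * t y j" if "j \<le> k" for j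
    using that by (simp add: s_def t_def Suc_diff_le prod.atLeastLessThan_Suc mult_ac)
  have s2: "s (Suc j) = fps_X ^ j * (c + w * y) * t (y * fps_X) j" for j
    unfolding s_def t_def prod.lessThan_Suc_shift prod.shift_bounds_Suc_ivl
    by (simp add: prod.distrib mult_ac)
  \<comment> \<open>For j = k the q-Pascal rule does not apply, and truncated subtraction would make
    the second term 1 instead of 0; hence the \<open>if\<close>.\<close>
  have pascal: "box_gf (Suc j) (k - j) = fps_X ^ (k - j) * box_gf j (k - j) +
      (if j = k then 0 else box_gf (Suc j) (k - Suc j))" if "j \<le> k" for j
  proof (cases "j = k")
    case False
    then have "k - j = Suc (k - Suc j)" using that by simp
    then show ?thesis using False by (simp add: box_gf_Suc_Suc del: power_Suc)
  qed simp
  have "(\<Sum>j\<le>Suc k. box_gf j (Suc k - j) * s j)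
      = s 0 + (\<Sum>j\<le>k. box_gf (Suc j) (k - j) * s (Suc j))"
    by (subst sum.atMost_Suc_shift) simp
  also have "(\<Sum>j\<le>k. box_gf (Suc j) (k - j) * s (Suc j))
      = (\<Sum>j\<le>k. fps_X ^ (k - j) * box_gf j (k - j) * s (Suc j))
        + (\<Sum>j\<le>k. (if j = k then 0 else box_gf (Suc j) (k - Suc j)) * s (Suc j))"
    by (simp add: pascal distrib_right flip: sum.distrib)
  also have "(\<Sum>j\<le>k. (if j = k then 0 else box_gf (Suc j) (k - Suc j)) * s (Suc j))
      = (\<Sum>j<k. box_gf (Suc j) (k - Suc j) * s (Suc j))"
    by (simp add: lessThan_Suc_atMost[symmetric])
  \<comment> \<open>The q^(k-j) of the q-Pascal rule and the q^j of \<open>s2\<close> combine to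
    q^k, which leaves the sum.\<close>
  also have "(\<Sum>j\<le>k. fps_X ^ (k - j) * box_gf j (k - j) * s (Suc j))
      = fps_X ^ k * (c + w * y) * (\<Sum>j\<le>k. box_gf j (k - j) * t (y * fps_X) j)"
    unfolding sum_distrib_left
  proof (rule sum.cong[OF refl])
    fix j assume "j \<in> {..k}"
    then have "fps_X ^ k = (fps_X ^ (k - j) * fps_X ^ j :: 'a fps)"
      by (simp flip: power_add)
    then show "fps_X ^ (k - j) * box_gf j (k - j) * s (Suc j)
        = fps_X ^ k * (c + w * y) * (box_gf j (k - j) * t (y * fps_X) j)"
      unfolding s2 by (simp add: mult_ac)
  qed
  finally have "(\<Sum>j\<le>Suc k. box_gf j (Suc k - j) * s j)
      = (\<Sum>j\<le>k. box_gf j (k - j) * s j)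
        + fps_X ^ k * (c + w * y) * (\<Sum>j\<le>k. box_gf j (k - j) * t (y * fps_X) j)"
    by (simp add: sum.atMost_shift)
  also have "(\<Sum>j\<le>k. box_gf j (k - j) * s j)
      = w * (1 - y * fps_X ^ k) * (\<Sum>j\<le>k. box_gf j (k - j) * t y j)"
    by (simp add: s1 sum_distrib_left mult_ac)
  \<comment> \<open>By \<open>IH\<close> both sums equal the same product, whatever y is, and w (1 -
    y q^k) + q^k (c + w y) = w + c q^k.\<close>
  finally have "(\<Sum>j\<le>Suc k. box_gf j (Suc k - j) * s j) = (\<Prod>i<Suc k. w + c * fps_X ^ i)"
    unfolding IH by (simp add: algebra_simps)
  then show ?case
    by (simp only: s_def mult.assoc)
qed simp

section \<open>Parity weights and compositions with bounded floors\<close>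

text \<open>The product over positions factors along a concatenation. The denominator at position i
  is m + 1 + i for every length, so a prefix keeps its weights.\<close>

definition floor_weight ::
    "nat \<Rightarrow> 'a::field \<Rightarrow> 'a \<Rightarrow> 'a \<Rightarrow> nat list \<Rightarrow> 'a fps" where
  "floor_weight m u v w l =
     (\<Prod>i<length l. fps_X ^ (l ! i) *
        fps_const (u ^ (l ! i div (m + 1 + i)) * (if odd (l ! i div (m + 1 + i)) then v else w)))"

lemma num_odd_conv_sum: "v ^ num_odd l = (\<Prod>i<length l. if odd (l ! i) then v else (1::'a::field))"
  by (induction l rule: rev_induct) (auto simp: num_odd_def nth_append)

lemma alh_weight_eq_floor_weight:
  assumes "length l = k"
  shows "alh_weight (m + k) k u v l = floor_weight m u v 1 l"
proof -
  have "fps_const (\<Prod>i<n. f i) = (\<Prod>i<n. fps_const (f i))" for n and f :: "nat \<Rightarrow> 'a"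
    by (induction n) (simp_all flip: fps_const_mult)
  then show ?thesis
    using assms
    by (simp add: alh_weight_def floor_weight_def alh_floor_def num_odd_conv_sum
      sum_list_sum_nth atLeast0LessThan prod.distrib power_sum flip: fps_const_mult)
qed

lemma mem_anti_lecture_hall:
  "l \<in> anti_lecture_hall (m + k) k \<longleftrightarrow> length l = k \<and>
     (\<forall>i. Suc i < k \<longrightarrow> l ! Suc i * (m + 1 + i) \<le> l ! i * (m + 2 + i))"
proof -
  have "real b / real (m + k - k + 1 + Suc i) \<le> real a / real (m + k - k + 1 + i)
      \<longleftrightarrow> b * (m + 1 + i) \<le> a * (m + 2 + i)" for a b i
  proof -
    have "real b / real (m + k - k + 1 + Suc i) \<le> real a / real (m + k - k + 1 + i)
      \<longleftrightarrow> real (b * (m + 1 + i)) \<le> real (a * (m + 2 + i))"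
      by (simp add: divide_simps) (simp add: algebra_simps)
    then show ?thesis by (simp only: of_nat_le_iff)
  qed
  then show ?thesis
    by (simp add: anti_lecture_hall_def)
qed

text \<open>The bound on entry i means that its floor is below M, which leaves finitely many
  lists.\<close>

definition alh_below :: "nat \<Rightarrow> nat \<Rightarrow> nat \<Rightarrow> nat list set" where
  "alh_below M m k = {l \<in> anti_lecture_hall (m + k) k. \<forall>i<k. l ! i < M * (m + 1 + i)}"

lemma finite_alh_below [simp]: "finite (alh_below M m k)"
proof (rule finite_subset[OF _ finite_lists_length_eq[of "{..M * (m + k)}" k]])
  show "alh_below M m k \<subseteq> {xs. set xs \<subseteq> {..M * (m + k)} \<and> length xs = k}"
  proof safe
    fix l x assume l: "l \<in> alh_below M m k" and "x \<in> set l"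
    then obtain i where i: "i < k" "x = l ! i"
      by (auto simp: alh_below_def mem_anti_lecture_hall in_set_conv_nth)
    then have "x < M * (m + 1 + i)" using l by (simp add: alh_below_def)
    also have "\<dots> \<le> M * (m + k)" using i by (intro mult_le_mono2) simp
    finally show "x \<le> M * (m + k)" by simp
  qed (auto simp: alh_below_def mem_anti_lecture_hall)
qed auto

section \<open>Splitting off the entries with positive floor\<close>

text \<open>Each ratio, hence each floor, goes up by exactly 1, so the hall condition is
  preserved.\<close>

definition alh_lift :: "nat \<Rightarrow> nat list \<Rightarrow> nat list" where
  "alh_lift m l = map (\<lambda>i. l ! i + (m + 1 + i)) [0..<length l]"

lemma length_alh_lift [simp]: "length (alh_lift m l) = length l"
  by (simp add: alh_lift_def)

lemma nth_alh_lift [simp]: "i < length l \<Longrightarrow> alh_lift m l ! i = l ! i + (m + 1 + i)"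
  by (simp add: alh_lift_def)

text \<open>Each lifted entry gains u and q^(m+1+i), and the parity of its floor flips, which swaps
  v and w. The entries of p lie below the denominators at their positions, so their floors are 0,
  hence even, and each contributes w.\<close>

lemma floor_weight_append:
  assumes p: "p \<in> box_partitions a (m + length l)"
  shows "floor_weight m u v w (alh_lift m l @ p) =
    fps_const w ^ a * (\<Prod>i<length l. fps_const u * fps_X ^ (m + 1) * fps_X ^ i) *
    (floor_weight m u w v l * fps_X ^ sum_list p)"
proof -
  let ?j = "length l" and ?l = "alh_lift m l @ p"
  define f where "f i = fps_X ^ (?l ! i) * fps_const (u ^ (?l ! i div (m + 1 + i)) *
    (if odd (?l ! i div (m + 1 + i)) then v else w))" for i
  have len: "length p = a" using p by (simp add: box_partitions_def)
  have "f i = (fps_const u * fps_X ^ (m + 1) * fps_X ^ i) * (fps_X ^ (l ! i) *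
        fps_const (u ^ (l ! i div (m + 1 + i)) * (if odd (l ! i div (m + 1 + i)) then w else v)))"
    if "i < ?j" for i
  proof -
    have d: "(l ! i + (m + 1 + i)) div (m + 1 + i) = Suc (l ! i div (m + 1 + i))"
      by (subst div_add_self2) simp_all
    have "?l ! i = l ! i + (m + 1 + i)"
      using that by (simp add: nth_append)
    then show ?thesis
      unfolding f_def by (simp only: d) (simp add: power_add mult_ac flip: fps_const_mult)
  qed
  then have 1: "(\<Prod>i<?j. f i)
      = (\<Prod>i<?j. fps_const u * fps_X ^ (m + 1) * fps_X ^ i) * floor_weight m u w v l"
    unfolding floor_weight_def prod.distrib[symmetric] by (intro prod.cong) auto
  have "f (?j + i) = fps_const w * fps_X ^ (p ! i)" if "i < a" for i
  proof -
    have "p ! i \<in> set p" using that len by simp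
    then have "p ! i \<le> m + ?j" using p by (auto simp: box_partitions_def)
    then have "p ! i div (m + 1 + (?j + i)) = 0" by simp
    moreover have "?l ! (?j + i) = p ! i"
      by (simp add: nth_append)
    ultimately show ?thesis
      unfolding f_def by (simp only:) simp
  qed
  then have 2: "(\<Prod>i<a. f (?j + i)) = fps_const w ^ a * fps_X ^ sum_list p"
    using len by (simp add: prod.distrib sum_list_sum_nth atLeast0LessThan power_sum)
  have "(\<Prod>i<?j + b. f i) = (\<Prod>i<?j. f i) * (\<Prod>i<b. f (?j + i))" for b
    by (induction b) (simp_all add: mult_ac)
  then have "floor_weight m u v w ?l = (\<Prod>i<?j. f i) * (\<Prod>i<a. f (?j + i))"
    by (simp add: floor_weight_def f_def len)
  then show ?thesis
    unfolding 1 2 by (simp add: mult_ac)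
qed

lemma mem_box_partitions:
  "p \<in> box_partitions a b \<longleftrightarrow>
     length p = a \<and> (\<forall>i. Suc i < a \<longrightarrow> p ! Suc i \<le> p ! i) \<and> (\<forall>i<a. p ! i \<le> b)"
proof -
  have "transp ((\<ge>) :: nat \<Rightarrow> nat \<Rightarrow> bool)"
    by (auto simp: transp_def)
  moreover have "set p \<subseteq> {..b} \<longleftrightarrow> (\<forall>i<length p. p ! i \<le> b)"
    by (metis atMost_iff in_set_conv_nth subset_iff)
  ultimately show ?thesis
    by (auto simp: box_partitions_def sorted_wrt_iff_nth_Suc_transp)
qed

lemma alh_below_empty [simp]: "alh_below M m 0 = {[]}"
  using mem_anti_lecture_hall[of _ m 0] by (auto simp: alh_below_def)

lemma length_alh_below: "l \<in> alh_below M m k \<Longrightarrow> length l = k"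
  by (simp add: alh_below_def mem_anti_lecture_hall)

text \<open>Ratios are at least 1 in the lifted prefix and below 1 in the tail, so the condition
  holds at the seam. Within the tail, entries decrease weakly while denominators grow.\<close>

lemma append_mem_alh_below:
  assumes jk: "j \<le> k" and l: "l \<in> alh_below M m j" and p: "p \<in> box_partitions (k - j) (m + j)"
  shows "alh_lift m l @ p \<in> alh_below (Suc M) m k"
proof -
  let ?L = "alh_lift m l @ p"
  have len: "length l = j" "length p = k - j"
    using l p by (simp_all add: length_alh_below mem_box_partitions)
  have lo: "?L ! i = l ! i + (m + 1 + i)" if "i < j" for i
    using that len by (simp add: nth_append)
  have hi: "?L ! i = p ! (i - j)" if "j \<le> i" for i
    using that len by (simp add: nth_append)
  have small: "?L ! i \<le> m + j" if "j \<le> i" "i < k" for i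
  proof -
    have "i - j < k - j" using that by simp
    then show ?thesis using p that by (simp add: hi mem_box_partitions)
  qed
  have "?L ! Suc i * (m + 1 + i) \<le> ?L ! i * (m + 2 + i)" if i: "Suc i < k" for i
  proof -
    consider "Suc i < j" | "Suc i = j" | "j \<le> i" by linarith
    then show ?thesis
    proof cases
      case 1
      then have "l ! Suc i * (m + 1 + i) \<le> l ! i * (m + 2 + i)"
        using l by (simp add: alh_below_def mem_anti_lecture_hall)
      then show ?thesis using 1 by (simp add: lo algebra_simps)
    next
      case 2
      then have "?L ! Suc i \<le> m + 2 + i" using small[of "Suc i"] i by simp
      moreover have "m + 1 + i \<le> ?L ! i" using 2 by (simp add: lo)
      ultimately have "?L ! Suc i * (m + 1 + i) \<le> (m + 2 + i) * ?L ! i"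
        by (rule mult_le_mono)
      then show ?thesis by (simp only: mult.commute)
    next
      case 3
      then have "Suc (i - j) < k - j" using i by simp
      then have "p ! Suc (i - j) \<le> p ! (i - j)" using p by (simp add: mem_box_partitions)
      then have "?L ! Suc i \<le> ?L ! i" using 3 by (simp add: hi Suc_diff_le)
      then show ?thesis by (rule mult_le_mono) simp
    qed
  qed
  moreover have "?L ! i < Suc M * (m + 1 + i)" if "i < k" for i
  proof (cases "i < j")
    case True
    then have "l ! i < M * (m + 1 + i)" using l by (simp add: alh_below_def)
    then show ?thesis using True by (simp add: lo)
  next
    case False
    then have "?L ! i < m + 1 + i" using small[of i] that by simp
    then show ?thesis by simp
  qed
  ultimately show ?thesis
    using len jk by (simp add: alh_below_def mem_anti_lecture_hall)
qed

lemma alh_below_split: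
  assumes L: "L \<in> alh_below (Suc M) m k"
  obtains j l p where "j \<le> k" "l \<in> alh_below M m j" "p \<in> box_partitions (k - j) (m + j)"
    "L = alh_lift m l @ p"
proof -
  \<comment> \<open>The cut is at the first floor equal to 0; the disjunct j = k covers lists all of
    whose floors are positive.\<close>
  define j where "j = (LEAST j. j = k \<or> L ! j < m + 1 + j)"
  have jP: "j = k \<or> L ! j < m + 1 + j"
    unfolding j_def by (rule LeastI[of _ k]) simp
  have jk: "j \<le> k"
    unfolding j_def by (rule Least_le) simp
  have low: "m + 1 + i \<le> L ! i" if "i < j" for i
    using not_less_Least[OF that[unfolded j_def]] by simp
  have len: "length L = k" using L by (rule length_alh_below)
  have step: "L ! Suc i * (m + 1 + i) \<le> L ! i * (m + 2 + i)" if "Suc i < k" for i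
    using L that by (simp add: alh_below_def mem_anti_lecture_hall)
  \<comment> \<open>Below the denominator, the hall condition is just monotonicity of the remainders.\<close>
  have decr: "L ! Suc i \<le> L ! i" if "Suc i < k" "L ! i \<le> m + i" for i
  proof (rule ccontr)
    assume "\<not> L ! Suc i \<le> L ! i"
    then have "Suc (L ! i) * (m + 1 + i) \<le> L ! Suc i * (m + 1 + i)"
      by (intro mult_le_mono1) simp
    also note step[OF that(1)]
    finally show False using that(2) by (simp add: algebra_simps)
  qed
  \<comment> \<open>Since m + j is at most m + i for every later i, the bound lets
    \<open>decr\<close> apply at each index in turn.\<close>
  have small: "L ! i \<le> m + j" if "j \<le> i" "i < k" for i
    using that
  proof (induction i rule: dec_induct)
    case base
    then show ?case using jP by simp
  next
    case (step i)
    then have "L ! i \<le> m + j" by simp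
    moreover have "L ! Suc i \<le> L ! i"
      using step calculation by (intro decr) simp_all
    ultimately show ?case by simp
  qed
  define l where "l = map (\<lambda>i. L ! i - (m + 1 + i)) [0..<j]"
  have "l \<in> alh_below M m j"
  proof -
    have "l ! Suc i * (m + 1 + i) \<le> l ! i * (m + 2 + i)" if "Suc i < j" for i
    proof -
      have "m + 1 + i \<le> L ! i" "m + 1 + Suc i \<le> L ! Suc i"
        using low[of i] low[of "Suc i"] that by simp_all
      \<comment> \<open>In these terms both sides of the inequality for \<open>L\<close> contain (m
        + 1 + i) (m + 2 + i), which cancels.\<close>
      then obtain a b where "L ! i = m + 1 + i + a" "L ! Suc i = m + 1 + Suc i + b"
        by (metis le_Suc_ex)
      then show ?thesis
        using step[of i] that jk by (simp add: l_def algebra_simps)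
    qed
    moreover have "l ! i < M * (m + 1 + i)" if "i < j" for i
    proof -
      have "L ! i < Suc M * (m + 1 + i)" using L that jk by (simp add: alh_below_def)
      then show ?thesis using low[OF that] that by (simp add: l_def)
    qed
    ultimately show ?thesis
      by (simp add: alh_below_def mem_anti_lecture_hall) (simp add: l_def)
  qed
  moreover have "drop j L \<in> box_partitions (k - j) (m + j)"
  proof -
    have "L ! Suc (j + i) \<le> L ! (j + i)" if "Suc i < k - j" for i
    proof (rule decr)
      have "L ! (j + i) \<le> m + j" using that by (intro small) simp_all
      then show "L ! (j + i) \<le> m + (j + i)" by simp
    qed (use that in simp)
    then show ?thesis
      using small len jk by (simp add: mem_box_partitions)
  qed
  moreover have "L = alh_lift m l @ drop j L"
  proof -
    have "alh_lift m l = take j L"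
    proof (rule nth_equalityI)
      fix i assume "i < length (alh_lift m l)"
      then have "i < j" by (simp add: l_def)
      then show "alh_lift m l ! i = take j L ! i"
        using low[of i] by (simp add: l_def)
    qed (use len jk in \<open>simp add: l_def\<close>)
    then show ?thesis by simp
  qed
  ultimately show ?thesis using jk that by blast
qed

text \<open>The cut can be read off the list: were l shorter than l', the entry at position
  \<open>length l\<close> would be at most m + \<open>length l\<close> as part of p, but larger as a
  lifted entry of l'.\<close>

lemma append_alh_lift_inject:
  assumes "p \<in> box_partitions (k - length l) (m + length l)"
    and "p' \<in> box_partitions (k - length l') (m + length l')"
    and eq: "alh_lift m l @ p = alh_lift m l' @ p'"
  shows "l = l' \<and> p = p'"
proof -
  have aux: "\<not> length l < length l'"
    if "p \<in> box_partitions (k - length l) (m + length l)"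
      and eq: "alh_lift m l @ p = alh_lift m l' @ p'" for l l' p p'
  proof
    assume less: "length l < length l'"
    have "length l + length p = length l' + length p'"
      using arg_cong[OF eq, of length] by simp
    then have "p ! 0 \<le> m + length l"
      using that(1) less by (simp add: mem_box_partitions)
    moreover have "p ! 0 = l' ! length l + (m + 1 + length l)"
      using arg_cong[OF eq, of "\<lambda>x. x ! length l"] less by (simp add: nth_append)
    ultimately show False by simp
  qed
  have len: "length l = length l'"
    using aux[OF assms(1) eq] aux[OF assms(2) eq[symmetric]] by simp
  then have lift: "alh_lift m l = alh_lift m l'" and "p = p'"
    using eq by simp_all
  moreover have "l ! i = l' ! i" if "i < length l" for i
    using arg_cong[OF lift, of "\<lambda>x. x ! i"] that len by simp
  ultimately show ?thesis
    using len by (auto intro: nth_equalityI)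
qed

lemma bij_betw_alh_below_Suc:
  "bij_betw (\<lambda>(j, l, p). alh_lift m l @ p)
     (SIGMA j:{..k}. alh_below M m j \<times> box_partitions (k - j) (m + j)) (alh_below (Suc M) m k)"
  unfolding bij_betw_def
proof
  show "inj_on (\<lambda>(j, l, p). alh_lift m l @ p)
     (SIGMA j:{..k}. alh_below M m j \<times> box_partitions (k - j) (m + j))"
  proof -
    have "(j, l, p) = (j', l', p')"
      if l: "l \<in> alh_below M m j" "l' \<in> alh_below M m j'"
        and p: "p \<in> box_partitions (k - j) (m + j)" "p' \<in> box_partitions (k - j') (m + j')"
        and eq: "alh_lift m l @ p = alh_lift m l' @ p'" for j l p j' l' p'
    proof -
      have "length l = j" "length l' = j'"
        using l by (simp_all add: length_alh_below)
      then show ?thesis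
        using append_alh_lift_inject[of p k l m p' l'] p eq by auto
    qed
    then show ?thesis
      unfolding inj_on_def by (clarsimp split: prod.splits)
  qed
  show "(\<lambda>(j, l, p). alh_lift m l @ p) `
     (SIGMA j:{..k}. alh_below M m j \<times> box_partitions (k - j) (m + j)) = alh_below (Suc M) m k"
  proof (intro equalityI subsetI)
    fix L assume "L \<in> alh_below (Suc M) m k"
    then obtain j l p where "j \<le> k" "l \<in> alh_below M m j" "p \<in> box_partitions (k - j) (m + j)"
        "L = alh_lift m l @ p"
      by (rule alh_below_split)
    then show "L \<in> (\<lambda>(j, l, p). alh_lift m l @ p) `
        (SIGMA j:{..k}. alh_below M m j \<times> box_partitions (k - j) (m + j))"
      by force
  qed (auto intro: append_mem_alh_below)
qed

section \<open>The recursion for the generating functions\<close>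

definition alh_below_gf ::
    "nat \<Rightarrow> nat \<Rightarrow> nat \<Rightarrow> 'a::field \<Rightarrow> 'a \<Rightarrow> 'a \<Rightarrow> 'a fps" where
  "alh_below_gf M m k u v w = (\<Sum>l\<in>alh_below M m k. floor_weight m u v w l)"

lemma alh_below_gf_empty [simp]: "alh_below_gf M m 0 u v w = 1"
  by (simp add: alh_below_gf_def floor_weight_def)

text \<open>The bijection in terms of generating functions. The term j = k has length k again, so
  the recursion descends in M and not in k.\<close>

lemma alh_below_gf_Suc:
  "alh_below_gf (Suc M) m k u v w =
     (\<Sum>j\<le>k. box_gf (k - j) (m + j) * fps_const w ^ (k - j) *
        (\<Prod>i<j. fps_const u * fps_X ^ (m + 1) * fps_X ^ i) * alh_below_gf M m j u w v)"
proof -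
  have "alh_below_gf (Suc M) m k u v w =
      (\<Sum>(j, l, p)\<in>(SIGMA j:{..k}. alh_below M m j \<times> box_partitions (k - j) (m + j)).
         floor_weight m u v w (alh_lift m l @ p))"
    unfolding alh_below_gf_def sum.reindex_bij_betw[OF bij_betw_alh_below_Suc, symmetric]
    by (simp add: case_prod_unfold)
  also have "\<dots> = (\<Sum>j\<le>k. \<Sum>(l, p)\<in>alh_below M m j \<times> box_partitions (k - j) (m + j).
         floor_weight m u v w (alh_lift m l @ p))"
    by (subst sum.Sigma) auto
  also have "\<dots> = (\<Sum>j\<le>k. \<Sum>(l, p)\<in>alh_below M m j \<times> box_partitions (k - j) (m + j).
         fps_const w ^ (k - j) * (\<Prod>i<j. fps_const u * fps_X ^ (m + 1) * fps_X ^ i) *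
         (floor_weight m u w v l * fps_X ^ sum_list p))"
    by (intro sum.cong refl) (auto simp: length_alh_below floor_weight_append)
  also have "\<dots> = (\<Sum>j\<le>k. fps_const w ^ (k - j) *
      (\<Prod>i<j. fps_const u * fps_X ^ (m + 1) * fps_X ^ i) *
      (alh_below_gf M m j u w v * box_gf (k - j) (m + j)))"
    unfolding alh_below_gf_def box_gf_def sum_product
    by (intro sum.cong refl)
       (simp only: sum.cartesian_product[symmetric] sum_distrib_left)
  finally show ?thesis
    by (simp only: mult_ac)
qed

section \<open>The recursion for the product\<close>

definition alh_product ::
    "nat \<Rightarrow> nat \<Rightarrow> 'a::field \<Rightarrow> 'a \<Rightarrow> 'a \<Rightarrow> 'a fps" where
  "alh_product m k u v w =
     box_gf k m * (\<Prod>i<k. fps_const w + fps_const v * (fps_const u * fps_X ^ (m + 1)) * fps_X ^ i) *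
     inverse (q_pochhammer ((fps_const u * fps_X ^ (m + 1))\<^sup>2) fps_X k)"

lemma alh_product_empty [simp]: "alh_product m 0 u v w = 1"
  by (simp add: alh_product_def)

text \<open>With x = u q^(m+1), multiplication by \<open>D k\<close> turns the denominators into the
  tail products of \<open>q_vandermonde_homogeneous\<close>, which then applies with c = v x and y =
  x^2.\<close>

lemma alh_product_rec:
  "alh_product m k u v w =
     (\<Sum>j\<le>k. box_gf (k - j) (m + j) * fps_const w ^ (k - j) *
        (\<Prod>i<j. fps_const u * fps_X ^ (m + 1) * fps_X ^ i) * alh_product m j u w v)"
    (is "_ = ?R")
proof -
  define x :: "'a fps" where "x = fps_const u * fps_X ^ (m + 1)"
  define D :: "nat \<Rightarrow> 'a fps" where "D = q_pochhammer (x\<^sup>2) fps_X"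
  have D0: "fps_nth (D j) 0 = 1" for j
    unfolding D_def by (rule q_pochhammer_fps_nth_0) (simp add: x_def power2_eq_square)
  have D_inv: "inverse (D j) * D j = 1" for j
    by (rule inverse_mult_eq_1) (simp add: D0)
  have D_nz: "D j \<noteq> 0" for j
    using D0[of j] by auto
  have D_split: "inverse (D j) * D k = (\<Prod>i=j..<k. 1 - x\<^sup>2 * fps_X ^ i)" if "j \<le> k" for j
  proof -
    have "D k = D j * (\<Prod>i=j..<k. 1 - x\<^sup>2 * fps_X ^ i)"
      unfolding D_def q_pochhammer_def using that
      by (simp add: prod.atLeastLessThan_concat flip: atLeast0LessThan)
    then show ?thesis by (simp add: D_inv flip: mult.assoc)
  qed
  \<comment> \<open>For each i one factor x moves into the second product, as the shape c + w y q^i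
    requires.\<close>
  have prods: "(\<Prod>i<j. x * fps_X ^ i) * (\<Prod>i<j. fps_const v + fps_const w * x * fps_X ^ i)
      = (\<Prod>i<j. fps_X ^ i) * (\<Prod>i<j. fps_const v * x + fps_const w * x\<^sup>2 * fps_X ^ i)" for j
    unfolding prod.distrib[symmetric]
    by (intro prod.cong refl) (simp add: algebra_simps power2_eq_square)
  have "?R * D k = (\<Sum>j\<le>k. box_gf (k - j) (m + j) * box_gf j m * fps_const w ^ (k - j) *
      ((\<Prod>i<j. x * fps_X ^ i) * (\<Prod>i<j. fps_const v + fps_const w * x * fps_X ^ i)) *
      (inverse (D j) * D k))"
    unfolding sum_distrib_right alh_product_def x_def[symmetric] D_def[symmetric]
    by (simp only: mult_ac)
  also have "\<dots> = (\<Sum>j\<le>k. box_gf k m * (box_gf j (k - j) * fps_const w ^ (k - j) *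
      (\<Prod>i<j. fps_X ^ i) * (\<Prod>i<j. fps_const v * x + fps_const w * x\<^sup>2 * fps_X ^ i) *
      (\<Prod>i=j..<k. 1 - x\<^sup>2 * fps_X ^ i)))"
    unfolding prods
    by (intro sum.cong refl) (simp add: box_gf_mult_box_gf D_split mult.assoc)
  also have "\<dots> = box_gf k m * (\<Prod>i<k. fps_const w + fps_const v * x * fps_X ^ i)"
    unfolding sum_distrib_left[symmetric] q_vandermonde_homogeneous ..
  also have "\<dots> = alh_product m k u v w * D k"
    unfolding alh_product_def x_def[symmetric] D_def[symmetric]
    by (simp add: D_inv mult.assoc)
  finally show ?thesis
    using D_nz[of k] by simp
qed

section \<open>Comparison of coefficients and convergence\<close>

lemma fps_nth_X_mult_eq_0:
  fixes f g :: "'a::field fps"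
  assumes "\<And>i. i < n \<Longrightarrow> fps_nth f i = 0" and "i < Suc n"
  shows "fps_nth (fps_X * (g * f)) i = 0"
  using assms by (auto simp: fps_mult_nth[of g] intro!: sum.neutral)

text \<open>Both sides obey the same recursion. Its terms for j = 0 agree exactly, and those for j >
  0 carry a factor q, so each increase of M gains one correct coefficient.\<close>

lemma alh_below_gf_nth:
  assumes "N < M"
  shows "fps_nth (alh_below_gf M m k u v w) N = fps_nth (alh_product m k u v w) N"
  using assms
proof (induction M arbitrary: k v w N)
  case (Suc M)
  let ?d = "\<lambda>j. alh_below_gf M m j u w v - alh_product m j u w v"
  have "fps_nth (box_gf (k - j) (m + j) * fps_const w ^ (k - j) *
      (\<Prod>i<j. fps_const u * fps_X ^ (m + 1) * fps_X ^ i) * ?d j) N = 0" for j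
  proof (cases j)
    case (Suc j')
    \<comment> \<open>The leading q is split off the i = 0 factor u q^(m+1), which leaves u
      q^m.\<close>
    have "fps_nth (fps_X * (box_gf (k - j) (m + j) * fps_const w ^ (k - j) *
        (fps_const u * fps_X ^ m * (\<Prod>i<j'. fps_const u * fps_X ^ (m + 1) * fps_X ^ Suc i)) * ?d j)) N = 0"
      using Suc.prems by (intro fps_nth_X_mult_eq_0[of M]) (simp_all add: Suc.IH)
    then show ?thesis
      unfolding Suc prod.lessThan_Suc_shift by (simp add: mult_ac)
  qed simp
  then have "fps_nth (alh_below_gf (Suc M) m k u v w - alh_product m k u v w) N = 0"
    by (subst alh_below_gf_Suc, subst alh_product_rec)
       (simp only: sum_subtractf[symmetric] right_diff_distrib[symmetric] fps_sum_nth sum.neutral_const)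
  then show ?case by simp
qed simp

lemma alh_product_eq:
  "alh_product m k u v 1 =
     gaussian_poly (m + k) k *
       (q_pochhammer (- fps_const (u * v) * fps_X ^ (m + 1)) fps_X k /
        q_pochhammer (fps_const (u ^ 2) * fps_X ^ (2 * (m + 1))) fps_X k)"
proof -
  let ?y = "fps_const (u ^ 2) * fps_X ^ (2 * (m + 1)) :: 'a fps"
  have y: "(fps_const u * fps_X ^ (m + 1))\<^sup>2 = ?y"
    by (simp add: power_mult_distrib power2_eq_square power_mult mult_2 power_add)
  have "fps_nth (q_pochhammer ?y fps_X k) 0 \<noteq> 0"
    by (subst q_pochhammer_fps_nth_0) simp_all
  then have "a / q_pochhammer ?y fps_X k = a * inverse (q_pochhammer ?y fps_X k)" for a
    by (rule fps_divide_unit)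
  moreover have "q_pochhammer (- fps_const (u * v) * fps_X ^ (m + 1)) fps_X k
      = (\<Prod>i<k. fps_const 1 + fps_const v * (fps_const u * fps_X ^ (m + 1)) * fps_X ^ i)"
    unfolding q_pochhammer_def by (intro prod.cong refl) (simp add: mult_ac flip: fps_const_mult)
  ultimately show ?thesis
    unfolding alh_product_def y gaussian_poly_eq_box_gf by (simp only: mult.assoc)
qed

theorem theorem2:
  fixes n k :: nat and u v :: "'a::field"
  assumes "k \<le> n"
  shows "(alh_weight n k u v has_sum
           (gaussian_poly n k *
             (q_pochhammer (- fps_const (u * v) * fps_X ^ (n - k + 1)) fps_X k /
              q_pochhammer (fps_const (u ^ 2) * fps_X ^ (2 * (n - k + 1))) fps_X k)))
         (anti_lecture_hall n k)"
proof -
  obtain m where n: "n = m + k"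
    using assms by (metis le_add_diff_inverse2)
  let ?A = "anti_lecture_hall n k" and ?f = "alh_weight n k u v"
  \<comment> \<open>Convergence of power series here is coefficientwise: each coefficient of the
    finite partial sums has to become constant eventually.\<close>
  have "eventually (\<lambda>F. fps_nth (sum ?f F) N = fps_nth (alh_product m k u v 1) N)
      (finite_subsets_at_top ?A)" for N
    unfolding eventually_finite_subsets_at_top
  proof (intro exI[of _ "alh_below (Suc N) m k"] conjI allI impI)
    show "alh_below (Suc N) m k \<subseteq> ?A"
      by (auto simp: alh_below_def n)
    fix F assume F: "finite F \<and> alh_below (Suc N) m k \<subseteq> F \<and> F \<subseteq> ?A"
    \<comment> \<open>Outside the bounded set some entry is at least (N + 1) (m + 1 + i), so the
      power of q exceeds N.\<close>
    have "fps_nth (?f l) N = 0" if l: "l \<in> F - alh_below (Suc N) m k" for l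
    proof -
      have "l \<in> anti_lecture_hall (m + k) k" using l F n by auto
      then obtain i where i: "i < length l" "Suc N * (m + 1 + i) \<le> l ! i"
        using l by (auto simp: alh_below_def mem_anti_lecture_hall not_less)
      have "Suc N \<le> Suc N * (m + 1 + i)" by simp
      also note i(2)
      also have "l ! i \<le> sum_list l" using i(1) by (simp add: elem_le_sum_list)
      finally show ?thesis by (simp add: alh_weight_def)
    qed
    then have "fps_nth (sum ?f F) N = fps_nth (sum ?f (alh_below (Suc N) m k)) N"
      unfolding fps_sum_nth using F by (intro sum.mono_neutral_right) auto
    also have "sum ?f (alh_below (Suc N) m k) = alh_below_gf (Suc N) m k u v 1"
      unfolding alh_below_gf_def n
      by (intro sum.cong refl alh_weight_eq_floor_weight length_alh_below)
    also have "fps_nth \<dots> N = fps_nth (alh_product m k u v 1) N"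
      by (rule alh_below_gf_nth) simp
    finally show "fps_nth (sum ?f F) N = fps_nth (alh_product m k u v 1) N" .
  qed simp
  then have "(?f has_sum alh_product m k u v 1) ?A"
    unfolding has_sum_def tendsto_fps_iff by blast
  then show ?thesis
    by (simp only: alh_product_eq n add_diff_cancel_right')
qed

end
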